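(* Let $G=(N,E)$ and $G'=(N,E')$ be DAGs. If $\mathcal{P}^{G'}\supseteq\mathcal{P}^G$ and $G'\supseteq G^*$, then $G'^\sim\supseteq G^{\mathrm{M}}$, and for every $s\in N$ the vertex-induced subgraph $G'[\{s\}\cup\mathrm{des}_G(s)]$ contains a perfect subgraph $H_s$ such that $H_s^\sim\supseteq G^{\mathrm{M}}[\{s\}\cup\mathrm{des}_G(s)]$.
   Context: DAG: finite directed graph without directed cycles; $\mathrm{pa}_G(s)$ = parents of $s$; $\mathrm{des}_G(s)$ = nodes $t\neq s$ reachable from $s$ by a directed path. $G^*=(N,E^* )$ with $E^*=\{(t,s):(s,t)\in E\}$ (all edges reversed). Containment of graphs means containment of edge sets (and vertex sets); a subgraph of $(N,E)$ is $(A,\tilde E)$ with $A\subseteq N$, $\tilde E\subseteq E$. For $A\subseteq N$, the vertex-induced subgraph is $G[A]=(A,\{(s,t)\in E:s,t\in A\})$. Nodes are joined if an edge connects them; a set is complete if all pairs are joined; a DAG is perfect if every parent set is complete. The undirected version is $G^\sim=(N,E\cup E^* )$. The moral graph is $G^{\mathrm{M}}=(N,E\cup E^*\cup\{(t_1,t_2):\exists s,\ t_1,t_2\in\mathrm{pa}_G(s),\ t_1\ne t_2\})$. Each node $s$ has a state space $\mathsf{X}_s$ (finite set with counting measure, or finite-dimensional real vector space with Lebesgue measure $\mu_s$), $\mu=\otimes_s\mu_s$; $\mathcal{P}^G$ is the set of probability distributions on $\times_s\mathsf{X}_s$ with $\mu$-density $p(x)=\prod_{s}k^s(x_s\mid x_{\mathrm{pa}_G(s)})$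 for some nonnegative measurable $k^s$ with $\int k^s(x_s\mid x_{\mathrm{pa}_G(s)})\,d\mu_s(x_s)=1$.
   Formalization: State spaces are assumed nontrivial (finite sets have at least two elements, real vector spaces have dimension at least 1); with one-point state spaces all models coincide and the claim fails, e.g. for a→c←b and its reversal. *)

theory Defs
  imports "HOL-Analysis.Analysis"
begin

definition dag :: "'n set \<Rightarrow> ('n \<times> 'n) set \<Rightarrow> bool" where
  "dag N E \<longleftrightarrow> finite N \<and> E \<subseteq> N \<times> N \<and> acyclic E"

definition pa :: "('n \<times> 'n) set \<Rightarrow> 'n \<Rightarrow> 'n set" where
  "pa E s = {t. (t, s) \<in> E}"

definition des :: "('n \<times> 'n) set \<Rightarrow> 'n \<Rightarrow> 'n set" where
  "des E s = {t. t \<noteq> s \<and> (s, t) \<in> E\<^sup>+}"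

definition undir :: "('n \<times> 'n) set \<Rightarrow> ('n \<times> 'n) set" where
  "undir E = E \<union> E\<inverse>"

definition moral :: "'n set \<Rightarrow> ('n \<times> 'n) set \<Rightarrow> ('n \<times> 'n) set" where
  "moral N E = E \<union> E\<inverse> \<union> {(t1, t2). \<exists>s\<in>N. t1 \<in> pa E s \<and> t2 \<in> pa E s \<and> t1 \<noteq> t2}"

definition induced :: "('n \<times> 'n) set \<Rightarrow> 'n set \<Rightarrow> ('n \<times> 'n) set" where
  "induced E A = {(s, t). (s, t) \<in> E \<and> s \<in> A \<and> t \<in> A}"

definition joined :: "('n \<times> 'n) set \<Rightarrow> 'n \<Rightarrow> 'n \<Rightarrow> bool" where
  "joined E a b \<longleftrightarrow> (a, b) \<in> E \<or> (b, a) \<in> E"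

definition complete :: "('n \<times> 'n) set \<Rightarrow> 'n set \<Rightarrow> bool" where
  "complete E A \<longleftrightarrow> (\<forall>a\<in>A. \<forall>b\<in>A. a \<noteq> b \<longrightarrow> joined E a b)"

definition perfect :: "'n set \<Rightarrow> ('n \<times> 'n) set \<Rightarrow> bool" where
  "perfect V E \<longleftrightarrow> (\<forall>s\<in>V. complete E (pa E s))"

text \<open>Admissible state spaces, all realised as measures on the common value type
  the type nat => real: a finite set (with at least two elements) with counting
  measure, or R^d (d \<ge> 1) with Lebesgue measure.\<close>
definition state_space :: "(nat \<Rightarrow> real) measure \<Rightarrow> bool" where
  "state_space M \<longleftrightarrow>
     (\<exists>A. finite A \<and> card A \<ge> 2 \<and> M = count_space A) \<or>
     (\<exists>d. d \<ge> 1 \<and> M = PiM {..<d} (\<lambda>_. lborel))"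

definition cond_density ::
  "('n \<Rightarrow> (nat \<Rightarrow> real) measure) \<Rightarrow> 'n \<Rightarrow> 'n set
     \<Rightarrow> ((nat \<Rightarrow> real) \<Rightarrow> ('n \<Rightarrow> (nat \<Rightarrow> real)) \<Rightarrow> ennreal) \<Rightarrow> bool" where
  "cond_density X s P k \<longleftrightarrow>
     (\<lambda>(x, y). k x y) \<in> borel_measurable (X s \<Otimes>\<^sub>M PiM P X) \<and>
     (\<forall>y\<in>space (PiM P X). (\<integral>\<^sup>+ x. k x y \<partial>X s) = 1)"

definition model ::
  "'n set \<Rightarrow> ('n \<times> 'n) set \<Rightarrow> ('n \<Rightarrow> (nat \<Rightarrow> real) measure)
     \<Rightarrow> ('n \<Rightarrow> (nat \<Rightarrow> real)) measure set" where
  "model N E X =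
     {density (PiM N X) (\<lambda>x. \<Prod>s\<in>N. k s (x s) (restrict x (pa E s))) | k.
        \<forall>s\<in>N. cond_density X s (pa E s) (k s)}"

end

theory Submission
  imports Defs
begin

text \<open>
  Order the nodes topologically for \<open>E'\<close>, which is a reverse topological order for \<open>E\<close>, by an
  injective rank \<open>r\<close>. On \<open>S = insert s (des E s)\<close> join \<open>u\<close> to each \<open>v\<close> with \<open>r u < r v \<le> r t\<close> for
  some moral neighbour \<open>t \<in> S\<close> of \<open>u\<close>: this graph is perfect and covers the moral graph on \<open>S\<close>,
  so everything reduces to showing that its edges lie in \<open>E'\<close>. If \<open>(u, v) \<notin> E'\<close>, then under every
  distribution of the model of \<open>E'\<close> the variables of \<open>u\<close> and \<open>v\<close> are independent given the other
  nodes ranked below \<open>v\<close>. Splitting each state space into two cells, one bit per node, the following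
  distribution of the model of \<open>E\<close> violates this: all nodes of \<open>S\<close> of rank at least \<open>r v\<close> copy a random
  bit of \<open>s\<close> along edges of \<open>E\<close>; either \<open>u\<close> is a child of \<open>t\<close> and copies its bit, or \<open>u\<close> is random
  and a common child of \<open>u\<close> and \<open>t\<close> carries the exclusive or; all remaining bits are \<open>False\<close>.
\<close>

section \<open>Topological ranks and null sets of finite product measures\<close>

lemma topological_rank:
  assumes "finite N" "finite E" "acyclic E"
  shows "\<exists>r :: 'n \<Rightarrow> nat. inj_on r N \<and> (\<forall>a\<in>N. \<forall>b\<in>N. (a, b) \<in> E \<longrightarrow> r a < r b)"
  using assms(1)
proof (induction "card N" arbitrary: N)
  case 0
  then show ?case by auto
next
  case (Suc n)
  have "wf (E\<inverse>)"
    using assms finite_acyclic_wf_converse by blast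
  moreover have "N \<noteq> {}"
    using Suc.hyps by auto
  ultimately obtain m where m: "m \<in> N" "\<And>b. (m, b) \<in> E \<Longrightarrow> b \<notin> N"
    by (metis converse_iff ex_in_conv wf_eq_minimal)
  have "card (N - {m}) = n"
    using Suc.hyps(2) Suc.prems m(1) by simp
  then obtain r :: "'n \<Rightarrow> nat" where r: "inj_on r (N - {m})"
      "\<forall>a\<in>N - {m}. \<forall>b\<in>N - {m}. (a, b) \<in> E \<longrightarrow> r a < r b"
    using Suc.hyps(1)[of "N - {m}"] Suc.prems by auto
  \<comment> \<open>A value above every rank already given: \<open>m\<close> has no edge into
    \<open>N\<close>, so it can be placed last.\<close>
  have big: "r a < Suc (sum r N)" if "a \<in> N" for a
    using member_le_sum[of a N r] that Suc.prems by simp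
  let ?r = "r(m := Suc (sum r N))"
  have "inj_on ?r N"
    using r(1) big by (force simp: inj_on_def)
  moreover have "\<forall>a\<in>N. \<forall>b\<in>N. (a, b) \<in> E \<longrightarrow> ?r a < ?r b"
    using r(2) big m by auto
  ultimately show ?case by blast
qed

lemma ennreal_prod_eq_0_iff:
  fixes f :: "'a \<Rightarrow> ennreal"
  assumes "finite A"
  shows "prod f A = 0 \<longleftrightarrow> (\<exists>a\<in>A. f a = 0)"
  using assms by (induction A) auto

text \<open>Allows blocks of coordinates to be fixed one after the other: \<open>merge\<close>
  pushes the product of the two block measures to the joint measure, and almost every section of a
  null set is null.\<close>

lemma (in product_sigma_finite) AE_PiM_Un:
  assumes "finite I" "finite J" "I \<inter> J = {}" "AE x in PiM (I \<union> J) M. P x"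
  shows "AE x in PiM I M. AE y in PiM J M. P (merge I J (x, y))"
proof -
  interpret I: finite_product_sigma_finite M I by standard fact
  interpret J: finite_product_sigma_finite M J by standard fact
  interpret pair_sigma_finite "PiM I M" "PiM J M" ..
  have "AE x in distr (PiM I M \<Otimes>\<^sub>M PiM J M) (PiM (I \<union> J) M) (merge I J). P x"
    by (subst distr_merge) (use assms in auto)
  then have "AE x in PiM I M \<Otimes>\<^sub>M PiM J M. P (merge I J x)"
    by (rule AE_distrD[rotated]) simp
  then show ?thesis
    by (rule AE_pair)
qed

text \<open>The box \<open>PiE I S\<close> has positive measure, so no null set contains it. This
  extracts points with prescribed cells from almost-everywhere statements.\<close>

lemma (in product_sigma_finite) AE_PiM_ex_PiE:
  assumes "finite I" "AE x in PiM I M. P x"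
    and "\<And>i. i \<in> I \<Longrightarrow> S i \<in> sets (M i) \<and> emeasure (M i) (S i) > 0"
  shows "\<exists>x\<in>PiE I S. P x"
proof (rule ccontr)
  assume "\<not> ?thesis"
  with assms(2) have "AE x in PiM I M. x \<notin> PiE I S"
    by (auto elim: eventually_mono)
  moreover have "PiE I S \<in> sets (PiM I M)"
    using assms by (intro sets_PiM_I_finite) auto
  ultimately have "emeasure (PiM I M) (PiE I S) = 0"
    using AE_iff_measurable[of "PiE I S" "PiM I M" "\<lambda>x. x \<notin> PiE I S"] sets.sets_into_space
    by fastforce
  moreover have "emeasure (PiM I M) (PiE I S) = (\<Prod>i\<in>I. emeasure (M i) (S i))"
    using assms by (intro emeasure_PiM) auto
  ultimately show False
    using assms(1,3) by (force simp: ennreal_prod_eq_0_iff)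
qed

section \<open>State spaces and the factors of a model\<close>

lemma state_space_sigma_finite:
  assumes "state_space M"
  shows "sigma_finite_measure M"
  using assms unfolding state_space_def
proof (elim disjE exE conjE)
  fix A :: "(nat \<Rightarrow> real) set" assume "finite A" "M = count_space A"
  then show ?thesis
    by (simp add: sigma_finite_measure_count_space_finite)
next
  fix d :: nat assume M: "M = PiM {..<d} (\<lambda>_. lborel :: real measure)"
  interpret product_sigma_finite "\<lambda>_::nat. lborel :: real measure"
    by standard
  show ?thesis
    using M by (simp add: sigma_finite)
qed

text \<open>The two cells encode one bit per node: two distinct points in the finite case, two unit
  cubes separated by coordinate 0 in the real case. Positive finite measure lets their indicators be
  normalised.\<close>

lemma state_space_split:
  assumes "state_space M"
  shows "\<exists>C :: bool \<Rightarrow> _. C True \<inter> C False = {} \<and>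
    (\<forall>i. C i \<in> sets M \<and> 0 < emeasure M (C i) \<and> emeasure M (C i) < \<infinity>)"
  using assms unfolding state_space_def
proof (elim disjE exE conjE)
  fix A :: "(nat \<Rightarrow> real) set" assume A: "finite A" "card A \<ge> 2" "M = count_space A"
  then obtain a b where "a \<in> A" "b \<in> A" "a \<noteq> b"
    by (metis card_le_Suc0_iff_eq not_less_eq_eq numeral_2_eq_2)
  then show ?thesis
    using A by (intro exI[of _ "\<lambda>i. if i then {a} else {b}"]) (auto simp: all_bool_eq)
next
  fix d :: nat assume d: "d \<ge> 1" "M = PiM {..<d} (\<lambda>_. lborel :: real measure)"
  interpret product_sigma_finite "\<lambda>_::nat. lborel :: real measure"
    by standard
  let ?C = "\<lambda>i. PiE {..<d} (\<lambda>_. if i then {0<..<1::real} else {1<..<2})"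
  have "?C i \<in> sets M \<and> emeasure M (?C i) = 1" for i
    unfolding d(2) by (auto intro!: sets_PiM_I_finite simp: emeasure_PiM)
  moreover have "?C True \<inter> ?C False = {}"
    using d(1) by (force simp: PiE_iff dest: bspec[of _ _ 0])
  ultimately show ?thesis
    by (intro exI[of _ ?C]) auto
qed

lemma model_cong:
  assumes "E \<subseteq> N \<times> N" "\<And>s. s \<in> N \<Longrightarrow> X s = Y s"
  shows "model N E X = model N E Y"
proof -
  have "PiM (pa E s) X = PiM (pa E s) Y" if "s \<in> N" for s
    using assms by (intro PiM_cong) (auto simp: pa_def)
  moreover have "PiM N X = PiM N Y"
    using assms by (intro PiM_cong) auto
  ultimately show ?thesis
    using assms(2) by (simp add: model_def cond_density_def cong: ball_cong)
qed

lemma cond_density_measurable: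
  assumes "cond_density X s P k" "s \<in> N" "P \<subseteq> N"
  shows "(\<lambda>x. k (x s) (restrict x P)) \<in> borel_measurable (PiM N X)"
proof -
  have "(\<lambda>(x, y). k x y) \<in> borel_measurable (X s \<Otimes>\<^sub>M PiM P X)"
    using assms by (simp add: cond_density_def)
  moreover have "(\<lambda>x. (x s, restrict x P)) \<in> PiM N X \<rightarrow>\<^sub>M X s \<Otimes>\<^sub>M PiM P X"
    using assms by (intro measurable_Pair measurable_component_singleton measurable_restrict_subset)
  ultimately show ?thesis
    using measurable_compose by fastforce
qed

lemma model_density_measurable:
  assumes "E \<subseteq> N \<times> N" "\<And>s. s \<in> N \<Longrightarrow> cond_density X s (pa E s) (k s)"
  shows "(\<lambda>x. \<Prod>s\<in>N. k s (x s) (restrict x (pa E s))) \<in> borel_measurable (PiM N X)"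
  using assms by (intro borel_measurable_prod_ennreal cond_density_measurable) (auto simp: pa_def)

section \<open>The independence imposed by a missing edge\<close>

text \<open>Nodes are integrated out in decreasing rank: the factor of the top node integrates to 1,
  and no other factor reads its value, because parents inside \<open>Z\<close> have smaller
  rank.\<close>

lemma (in product_sigma_finite) nn_integral_later_factors:
  fixes r :: "'i \<Rightarrow> nat"
  assumes "finite Z" "inj_on r Z" "B \<inter> Z = {}" "y \<in> space (PiM B M)"
    and "\<And>a. a \<in> Z \<Longrightarrow> P a \<subseteq> B \<union> {b \<in> Z. r b < r a}"
    and "\<And>a. a \<in> Z \<Longrightarrow>
      (\<lambda>(x, y). k a x y) \<in> borel_measurable (M a \<Otimes>\<^sub>M PiM (P a) M) \<and>
      (\<forall>y\<in>space (PiM (P a) M). (\<integral>\<^sup>+ x. k a x y \<partial>M a) = (1::ennreal))"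
  shows "(\<integral>\<^sup>+ z. (\<Prod>a\<in>Z. k a (z a) (restrict (merge B Z (y, z)) (P a))) \<partial>PiM Z M) = 1"
  using assms
proof (induction "card Z" arbitrary: Z)
  case 0
  then show ?case by (simp add: PiM_empty nn_integral_count_space_finite)
next
  case (Suc n)
  have "Z \<noteq> {}" using Suc.hyps(2) by auto
  have "Max (r ` Z) \<in> r ` Z"
    using \<open>Z \<noteq> {}\<close> Suc.prems(1) by simp
  then obtain m where m: "m \<in> Z" "r m = Max (r ` Z)"
    by auto
  define Z' where "Z' = Z - {m}"
  have Z: "Z = insert m Z'" "m \<notin> Z'" "finite Z'" "card Z' = n"
    using m Suc.prems(1) Suc.hyps(2) by (auto simp: Z'_def)
  have lt: "r a < r m" if "a \<in> Z'" for a
  proof -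
    have "r a \<le> r m"
      using m that Suc.prems(1) by (auto simp: Z'_def)
    moreover have "r a \<noteq> r m"
      using Suc.prems(2) that m by (auto simp: Z'_def inj_on_def)
    ultimately show ?thesis by simp
  qed
  let ?F = "\<lambda>Z z a. k a (z a) (restrict (merge B Z (y, z)) (P a))"
  have meas: "(\<lambda>z. ?F Z z a) \<in> borel_measurable (PiM Z M)" if "a \<in> Z" for a
  proof -
    have "(\<lambda>z. (z a, restrict (merge B Z (y, z)) (P a))) \<in> PiM Z M \<rightarrow>\<^sub>M M a \<Otimes>\<^sub>M PiM (P a) M"
    proof (intro measurable_Pair measurable_component_singleton that)
      have "(\<lambda>z. merge B Z (y, z)) \<in> PiM Z M \<rightarrow>\<^sub>M PiM (B \<union> Z) M"
        by (rule measurable_compose[OF measurable_Pair1' measurable_merge]) fact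
      then show "(\<lambda>z. restrict (merge B Z (y, z)) (P a)) \<in> PiM Z M \<rightarrow>\<^sub>M PiM (P a) M"
        by (rule measurable_compose, intro measurable_restrict_subset)
          (use Suc.prems(5)[OF that] in blast)
    qed
    from measurable_compose[OF this, of "\<lambda>(x, y). k a x y" borel] Suc.prems(6)[OF that]
    show ?thesis by simp
  qed
  have "(\<integral>\<^sup>+ z. (\<Prod>a\<in>Z. ?F Z z a) \<partial>PiM Z M) =
    (\<integral>\<^sup>+ z. (\<integral>\<^sup>+ x. (\<Prod>a\<in>Z. ?F Z (z(m := x)) a) \<partial>M m) \<partial>PiM Z' M)"
    unfolding Z(1) using meas unfolding Z(1)
    by (intro product_nn_integral_insert Z) (auto intro!: borel_measurable_prod_ennreal)
  also have "\<dots> = (\<integral>\<^sup>+ z. (\<Prod>a\<in>Z'. ?F Z' z a) \<partial>PiM Z' M)"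
  proof (intro nn_integral_cong)
    fix z assume z: "z \<in> space (PiM Z' M)"
    have old: "?F Z (z(m := x)) a = ?F Z' z a" if "a \<in> Z'" for a x
    proof -
      have "P a \<subseteq> B \<union> Z'" "m \<notin> P a"
        using Suc.prems(3) Suc.prems(5)[of a] that Z(1) m(1) lt[OF that] by auto
      then have "restrict (merge B Z (y, z(m := x))) (P a) = restrict (merge B Z' (y, z)) (P a)"
        using Z by (auto simp: merge_def restrict_def fun_eq_iff)
      then show ?thesis using that Z by auto
    qed
    define w where "w = restrict (merge B Z' (y, z)) (P m)"
    have Pm: "P m \<subseteq> B \<union> Z'" "m \<notin> P m"
      using Suc.prems(3) Suc.prems(5)[of m] Z(1) m(1) by auto
    then have w: "restrict (merge B Z (y, z(m := x))) (P m) = w" for x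
      using Z by (auto simp: w_def merge_def restrict_def fun_eq_iff)
    have "merge B Z' (y, z) \<in> space (PiM (B \<union> Z') M)"
      using z Suc.prems(4) by (auto simp: space_PiM PiE_iff merge_def extensional_def)
    then have w_space: "w \<in> space (PiM (P m) M)"
      using Pm by (auto simp: w_def space_PiM PiE_iff)
    have km: "(\<lambda>x. k m x w) \<in> borel_measurable (M m)" "(\<integral>\<^sup>+ x. k m x w \<partial>M m) = 1"
      using Suc.prems(6)[OF m(1)] w_space measurable_Pair2 by fastforce+
    have "(\<integral>\<^sup>+ x. (\<Prod>a\<in>Z. ?F Z (z(m := x)) a) \<partial>M m) =
      (\<integral>\<^sup>+ x. k m x w * (\<Prod>a\<in>Z'. ?F Z' z a) \<partial>M m)"
    proof (intro nn_integral_cong)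
      fix x
      have "(\<Prod>a\<in>Z. ?F Z (z(m := x)) a) = ?F Z (z(m := x)) m * (\<Prod>a\<in>Z'. ?F Z (z(m := x)) a)"
        by (subst (1) Z(1)) (use Z in simp)
      then show "(\<Prod>a\<in>Z. ?F Z (z(m := x)) a) = k m x w * (\<Prod>a\<in>Z'. ?F Z' z a)"
        using old w by simp
    qed
    also have "\<dots> = (\<Prod>a\<in>Z'. ?F Z' z a)"
      using km by (simp add: nn_integral_multc)
    finally show "(\<integral>\<^sup>+ x. (\<Prod>a\<in>Z. ?F Z (z(m := x)) a) \<partial>M m) = (\<Prod>a\<in>Z'. ?F Z' z a)" .
  qed
  also have "\<dots> = 1"
  proof (rule Suc.hyps(1))
    show "P a \<subseteq> B \<union> {b \<in> Z'. r b < r a}" if "a \<in> Z'" for a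
      using Suc.prems(5)[of a] that Z(1) lt[OF that] by auto
  qed (use Suc.prems Z in \<open>auto intro: inj_on_subset\<close>)
  finally show ?case .
qed

text \<open>
  A support form of \<open>u \<bottom> v | rest\<close>: mixing the value of \<open>u\<close> from one point of the support with
  the value of \<open>v\<close> from another one stays in the support. Only the positivity of the factors is
  compared, so no conditional densities have to be computed.
\<close>
lemma separated_support:
  fixes X :: "'n \<Rightarrow> (nat \<Rightarrow> real) measure" and r :: "'n \<Rightarrow> nat"
  assumes "product_sigma_finite X" "finite N" "E \<subseteq> N \<times> N"
    and inj: "inj_on r N" and rank: "\<And>a b. (a, b) \<in> E \<Longrightarrow> r a < r b"
    and p: "density (PiM N X) p \<in> model N E X" "p \<in> borel_measurable (PiM N X)"
    and uv: "u \<in> N" "v \<in> N" "r u < r v" "(u, v) \<notin> E"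
    and S: "\<And>a. a \<in> N \<Longrightarrow> S a \<in> sets (X a) \<and> emeasure (X a) (S a) > 0"
    and T: "\<And>a. a \<in> N \<Longrightarrow> T a \<in> sets (X a) \<and> emeasure (X a) (T a) > 0"
    and eq: "\<And>a. a \<in> N \<Longrightarrow> r a < r v \<Longrightarrow> a \<noteq> u \<Longrightarrow> S a = T a"
    and pos: "\<And>x. x \<in> PiE N S \<Longrightarrow> p x > 0" "\<And>x. x \<in> PiE N T \<Longrightarrow> p x > 0"
  shows "\<exists>x\<in>space (PiM N X). (\<forall>a\<in>N. r a < r v \<longrightarrow> x a \<in> S a) \<and> x v \<in> T v \<and> p x > 0"
proof (rule ccontr)
  assume "\<not> ?thesis"
  then have zero: "p x = 0"
    if "x \<in> space (PiM N X)" "\<forall>a\<in>N. r a < r v \<longrightarrow> x a \<in> S a" "x v \<in> T v" for x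
    using that by (auto simp: not_less)
  interpret product_sigma_finite X by fact
  interpret N: finite_product_sigma_finite X N by standard fact
  obtain k where k: "\<And>a. a \<in> N \<Longrightarrow> cond_density X a (pa E a) (k a)"
    and dens: "density (PiM N X) p =
      density (PiM N X) (\<lambda>x. \<Prod>a\<in>N. k a (x a) (restrict x (pa E a)))"
    using p(1) by (auto simp: model_def)
  define f where "f = (\<lambda>x a. k a (x a) (restrict x (pa E a)))"
  \<comment> \<open>A distribution fixes its density only up to null sets; hence the choice of
    points block by block below.\<close>
  have "AE x in PiM N X. p x = (\<Prod>a\<in>N. f x a)"
    using N.density_unique_iff[OF p(2) model_density_measurable[OF assms(3) k]] dens
    by (simp add: f_def)
  \<comment> \<open>\<open>B\<close> will hold the nodes of rank at most \<open>r v\<close>, split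
    into \<open>R\<close>, \<open>u\<close> and \<open>v\<close>; \<open>Z\<close> holds the later
    ones. \<open>G\<close> reassembles a point from its values on these four blocks.\<close>
  define R where "R = {a\<in>N. r a < r v} - {u}"
  define Z where "Z = {a\<in>N. r v < r a}"
  define B where "B = (R \<union> {u}) \<union> {v}"
  have other: "r a \<noteq> r v" if "a \<in> N" "a \<noteq> v" for a
    using inj uv(2) that by (auto simp: inj_on_def)
  have N: "N = B \<union> Z" "B \<inter> Z = {}" "v \<notin> R" "u \<notin> R" "u \<noteq> v" "finite R" "finite B" "finite Z"
    using uv other assms(2) by (auto simp: B_def R_def Z_def linorder_neq_iff)
  have "AE x in PiM (B \<union> Z) X. p x = (\<Prod>a\<in>N. f x a)"
    using \<open>AE x in PiM N X. p x = (\<Prod>a\<in>N. f x a)\<close> unfolding N(1)[symmetric] .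
  define G :: "('n \<Rightarrow> nat \<Rightarrow> real) \<Rightarrow> _" where "G = (\<lambda>x y w z.
    merge B Z (merge (R \<union> {u}) {v} (merge R {u} (x, y), w), z))"
  define Q where "Q = (\<lambda>x y w. AE z in PiM Z X. p (G x y w z) = (\<Prod>a\<in>N. f (G x y w z) a))"
  have "AE b in PiM B X. AE z in PiM Z X. p (merge B Z (b, z)) = (\<Prod>a\<in>N. f (merge B Z (b, z)) a)"
    by (rule AE_PiM_Un[OF N(7,8,2)]) fact
  from AE_PiM_Un[of "R \<union> {u}" "{v}", folded B_def, OF _ _ _ this]
  have "AE b in PiM (R \<union> {u}) X. AE w in PiM {v} X. AE z in PiM Z X.
      p (merge B Z (merge (R \<union> {u}) {v} (b, w), z)) =
      (\<Prod>a\<in>N. f (merge B Z (merge (R \<union> {u}) {v} (b, w), z)) a)"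
    using N by simp
  from AE_PiM_Un[of R "{u}", OF _ _ _ this] have "AE x in PiM R X. AE y in PiM {u} X. AE w in PiM {v} X. Q x y w"
    using N unfolding Q_def G_def by simp
  \<comment> \<open>The values \<open>x\<close> on \<open>R\<close> are common to all points.
    \<open>y1\<close> comes from \<open>S\<close> and \<open>y0\<close> from \<open>T\<close>;
    \<open>w0\<close> has to suit both, so that the identity also covers the mixed values
    \<open>x\<close>, \<open>y1\<close>, \<open>w0\<close>.\<close>
  from AE_PiM_ex_PiE[OF _ this, of S] obtain x
    where x: "x \<in> PiE R S" and AEx: "AE y in PiM {u} X. AE w in PiM {v} X. Q x y w"
    using N S by (auto simp: R_def)
  from AE_PiM_ex_PiE[OF _ AEx, of S] obtain y1
    where y1: "y1 \<in> PiE {u} S" and AEy1: "AE w in PiM {v} X. Q x y1 w"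
    using S uv by auto
  from AE_PiM_ex_PiE[OF _ AEx, of T] obtain y0
    where y0: "y0 \<in> PiE {u} T" and AEy0: "AE w in PiM {v} X. Q x y0 w"
    using T uv by auto
  from AE_PiM_ex_PiE[OF _ AEy1, of S] obtain w1
    where w1: "w1 \<in> PiE {v} S" and Q11: "Q x y1 w1"
    using S uv by auto
  have "AE w in PiM {v} X. Q x y1 w \<and> Q x y0 w"
    using AEy1 AEy0 by auto
  from AE_PiM_ex_PiE[OF _ this, of T] obtain w0
    where w0: "w0 \<in> PiE {v} T" and Q10: "Q x y1 w0" and Q00: "Q x y0 w0"
    using T uv by auto
  from AE_PiM_ex_PiE[OF _ Q11[unfolded Q_def], of S] obtain z1
    where z1: "z1 \<in> PiE Z S" and eq1: "p (G x y1 w1 z1) = (\<Prod>a\<in>N. f (G x y1 w1 z1) a)"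
    using S N(8) by (auto simp: Z_def)
  from AE_PiM_ex_PiE[OF _ Q00[unfolded Q_def], of T] obtain z0
    where z0: "z0 \<in> PiE Z T" and eq0: "p (G x y0 w0 z0) = (\<Prod>a\<in>N. f (G x y0 w0 z0) a)"
    using T N(8) by (auto simp: Z_def)
  have G: "G x' y' w' z' a = (if a \<in> R then x' a else if a = u then y' a else
      if a = v then w' a else if a \<in> Z then z' a else undefined)" for x' y' w' z' a
    using N by (auto simp: G_def merge_def B_def)
  have RT: "S a = T a" if "a \<in> R" for a
    using that eq by (auto simp: R_def)
  have "G x y1 w1 z1 \<in> PiE N S"
    using x y1 w1 z1 N by (auto simp: PiE_iff extensional_def G B_def)
  from pos(1)[OF this] have f1: "f (G x y1 w1 z1) a \<noteq> 0" if "a \<in> N" for a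
    using that eq1 assms(2) by (metis less_irrefl prod_zero)
  have "G x y0 w0 z0 \<in> PiE N T"
    using x y0 w0 z0 N RT by (auto simp: PiE_iff extensional_def G B_def)
  from pos(2)[OF this] have f0: "f (G x y0 w0 z0) a \<noteq> 0" if "a \<in> N" for a
    using that eq0 assms(2) by (metis less_irrefl prod_zero)
  have pa: "pa E a \<subseteq> {b\<in>N. r b < r a}" for a
    using assms(3) rank by (auto simp: pa_def)
  \<comment> \<open>Factors of nodes in \<open>B\<close> never read coordinates in \<open>Z\<close>,
    so \<open>undefined\<close> may stand there.\<close>
  define c where "c = (\<Prod>a\<in>B. f (G x y1 w0 (\<lambda>_. undefined)) a)"
  have fc: "f (G x y1 w0 z) a \<noteq> 0 \<and> f (G x y1 w0 z) a = f (G x y1 w0 (\<lambda>_. undefined)) a"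
    if "a \<in> B" for a z
  proof (cases "a = v")
    \<comment> \<open>As \<open>(u, v)\<close> is no edge, the factor of \<open>v\<close> does not
      read \<open>u\<close> and agrees with its value at the point drawn from
      \<open>T\<close>.\<close>
    case True
    have "G x y1 w0 z b = G x y0 w0 z0 b \<and> G x y1 w0 z b = G x y1 w0 (\<lambda>_. undefined) b"
      if "b \<in> pa E v" for b
      using that pa[of v] uv(4) by (auto simp: G R_def pa_def)
    then have "restrict (G x y1 w0 z) (pa E v) = restrict (G x y0 w0 z0) (pa E v) \<and>
        restrict (G x y1 w0 z) (pa E v) = restrict (G x y1 w0 (\<lambda>_. undefined)) (pa E v)"
      by (intro conjI restrict_ext) blast+
    moreover have "G x y1 w0 z v = G x y0 w0 z0 v" "G x y1 w0 z v = G x y1 w0 (\<lambda>_. undefined) v"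
      using N by (auto simp: G)
    ultimately show ?thesis
      using f0[OF uv(2)] unfolding True f_def by metis
  next
    \<comment> \<open>The other factors of \<open>B\<close> read only nodes ranked below
      \<open>v\<close> and agree with their values at the point drawn from \<open>S\<close>.\<close>
    case False
    then have a: "a \<in> R \<union> {u}" "a \<in> N" "r a < r v"
      using \<open>a \<in> B\<close> uv by (auto simp: B_def R_def)
    have same: "G x y1 w0 z b = G x y1 w1 z1 b \<and> G x y1 w0 z b = G x y1 w0 (\<lambda>_. undefined) b"
      if "b \<in> N" "r b < r v" for b
      using that by (auto simp: G R_def)
    then have "restrict (G x y1 w0 z) (pa E a) = restrict (G x y1 w1 z1) (pa E a) \<and>
        restrict (G x y1 w0 z) (pa E a) = restrict (G x y1 w0 (\<lambda>_. undefined)) (pa E a)"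
      using pa[of a] a(3) by (intro conjI restrict_ext) (auto dest: less_trans)
    then show ?thesis
      using f1[OF a(2)] same[OF a(2,3)] unfolding f_def by metis
  qed
  have c: "c \<noteq> 0"
    using fc unfolding c_def ennreal_prod_eq_0_iff[OF N(7)] by blast
  define b where "b = merge (R \<union> {u}) {v} (merge R {u} (x, y1), w0)"
  have in_space: "t \<in> space (X a)" if "t \<in> S a \<or> t \<in> T a" "a \<in> N" for t a
    using that S T sets.sets_into_space by blast
  have b: "b \<in> space (PiM B X)"
  proof -
    have b_eq: "b a = (if a \<in> R then x a else if a = u then y1 a else
        if a = v then w0 a else undefined)" for a
      by (simp add: b_def merge_def)
    have "b a \<in> space (X a)" if "a \<in> B" for a
    proof -
      have "a \<in> N"
        using that N(1) by blast
      consider "a \<in> R" | "a = u" | "a = v"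
        using \<open>a \<in> B\<close> by (auto simp: B_def)
      then have "b a \<in> S a \<or> b a \<in> T a"
        by cases (use N(3-5) PiE_mem[OF x] PiE_mem[OF y1] PiE_mem[OF w0] in \<open>simp_all add: b_eq\<close>)
      then show ?thesis
        using in_space \<open>a \<in> N\<close> by blast
    qed
    moreover have "b \<in> extensional B"
      by (auto simp: extensional_def B_def b_eq)
    ultimately show ?thesis
      by (simp add: space_PiM PiE_iff)
  qed
  have prod: "(\<Prod>a\<in>N. f (G x y1 w0 z) a) =
      c * (\<Prod>a\<in>Z. k a (z a) (restrict (merge B Z (b, z)) (pa E a)))" for z
  proof -
    have "(\<Prod>a\<in>B. f (G x y1 w0 z) a) = c"
      unfolding c_def by (intro prod.cong refl fc[THEN conjunct2])
    moreover have "f (G x y1 w0 z) a = k a (z a) (restrict (merge B Z (b, z)) (pa E a))"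
      if "a \<in> Z" for a
      using that N by (auto simp: f_def b_def G_def merge_def B_def)
    ultimately show ?thesis
      by (subst N(1)) (use N in \<open>simp add: prod.union_disjoint\<close>)
  qed
  \<comment> \<open>With the mixed values on \<open>B\<close>, the density vanishes for every choice
    on \<open>Z\<close>. Since \<open>c\<close> is nonzero, the later factors must vanish almost
    everywhere, yet they integrate to 1.\<close>
  have "AE z in PiM Z X. (\<Prod>a\<in>Z. k a (z a) (restrict (merge B Z (b, z)) (pa E a))) = 0"
    using Q10[unfolded Q_def] AE_space
  proof eventually_elim
    case (elim z)
    have "G x y1 w0 z \<in> space (PiM N X)"
      using b elim(2) N(2) unfolding G_def b_def[symmetric] N(1)
      by (auto simp: space_PiM PiE_iff merge_def extensional_def)
    moreover have "\<forall>a\<in>N. r a < r v \<longrightarrow> G x y1 w0 z a \<in> S a"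
      using x y1 by (auto simp: G R_def)
    moreover have "G x y1 w0 z v \<in> T v"
      using w0 N by (auto simp: G)
    ultimately have "p (G x y1 w0 z) = 0"
      by (rule zero)
    then show ?case
      using elim(1) prod c by simp
  qed
  then have "(\<integral>\<^sup>+ z. (\<Prod>a\<in>Z. k a (z a) (restrict (merge B Z (b, z)) (pa E a))) \<partial>PiM Z X) = 0"
    by (subst nn_integral_cong_AE[where v = "\<lambda>_. 0"]) auto
  moreover have "(\<integral>\<^sup>+ z. (\<Prod>a\<in>Z. k a (z a) (restrict (merge B Z (b, z)) (pa E a))) \<partial>PiM Z X) = 1"
  proof (rule nn_integral_later_factors)
    show "inj_on r Z"
      using inj by (rule inj_on_subset) (auto simp: Z_def)
    show "pa E a \<subseteq> B \<union> {b \<in> Z. r b < r a}" if "a \<in> Z" for a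
      using pa[of a] N(1) by blast
    show "(\<lambda>(x, y). k a x y) \<in> borel_measurable (X a \<Otimes>\<^sub>M PiM (pa E a) X) \<and>
        (\<forall>y\<in>space (PiM (pa E a) X). (\<integral>\<^sup>+ x. k a x y \<partial>X a) = 1)" if "a \<in> Z" for a
      using k[of a] that by (simp add: cond_density_def Z_def)
  qed (fact N(8) N(2) b)+
  ultimately show False by simp
qed

section \<open>A distribution violating the independence\<close>

text \<open>Given its parents, node \<open>a\<close> follows the reference measure restricted to the
  cell \<open>D a i\<close> and normalised, where \<open>i\<close> is the label computed by
  \<open>h a\<close>.\<close>

lemma model_with_support:
  assumes "dag N E"
    and D: "\<And>a i. a \<in> N \<Longrightarrow> D a i \<in> sets (X a) \<and> 0 < emeasure (X a) (D a i) \<and> emeasure (X a) (D a i) < \<infinity>"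
    and h: "\<And>a. a \<in> N \<Longrightarrow> h a \<in> PiM (pa E a) X \<rightarrow>\<^sub>M count_space (UNIV :: 'i :: countable set)"
  shows "\<exists>p. p \<in> borel_measurable (PiM N X) \<and> density (PiM N X) p \<in> model N E X \<and>
    (\<forall>x. p x > 0 \<longleftrightarrow> (\<forall>a\<in>N. x a \<in> D a (h a (restrict x (pa E a)))))"
proof -
  define g where "g = (\<lambda>a i x. indicator (D a i) x / emeasure (X a) (D a i))"
  define k where "k = (\<lambda>a x y. g a (h a y) x)"
  have k: "cond_density X a (pa E a) (k a)" if a: "a \<in> N" for a
    unfolding cond_density_def
  proof (intro conjI ballI)
    have "(\<lambda>xy. g a (h a (snd xy)) (fst xy)) \<in> borel_measurable (X a \<Otimes>\<^sub>M PiM (pa E a) X)"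
    \<comment> \<open>Countably many labels reduce joint measurability to one label at a
      time.\<close>
    proof (rule measurable_compose_countable)
      show "(\<lambda>xy. g a i (fst xy)) \<in> borel_measurable (X a \<Otimes>\<^sub>M PiM (pa E a) X)" for i
        unfolding g_def using D[OF a, of i]
        by (intro measurable_compose[OF measurable_fst] borel_measurable_divide_ennreal
          borel_measurable_indicator borel_measurable_const) auto
      show "(\<lambda>xy. h a (snd xy)) \<in> X a \<Otimes>\<^sub>M PiM (pa E a) X \<rightarrow>\<^sub>M count_space UNIV"
        using measurable_compose[OF measurable_snd h[OF a]] .
    qed
    then show "(\<lambda>(x, y). k a x y) \<in> borel_measurable (X a \<Otimes>\<^sub>M PiM (pa E a) X)"
      by (simp add: k_def case_prod_beta)
    fix y
    show "(\<integral>\<^sup>+ x. k a x y \<partial>X a) = 1"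
      using D[OF a, of "h a y"] unfolding k_def g_def
      by (subst nn_integral_divide) (auto intro!: ennreal_divide_self)
  qed
  define p where "p = (\<lambda>x. \<Prod>a\<in>N. k a (x a) (restrict x (pa E a)))"
  have "p \<in> borel_measurable (PiM N X)"
    unfolding p_def using assms(1) k by (intro model_density_measurable) (auto simp: dag_def)
  moreover have "density (PiM N X) p \<in> model N E X"
    unfolding p_def model_def using k by blast
  moreover have "k a t y \<noteq> 0 \<longleftrightarrow> t \<in> D a (h a y)" if "a \<in> N" for a t y
    using D[OF that, of "h a y"] by (auto simp: k_def g_def ennreal_divide_eq_0_iff indicator_def)
  then have "p x > 0 \<longleftrightarrow> (\<forall>a\<in>N. x a \<in> D a (h a (restrict x (pa E a))))" for x
    using assms(1) by (auto simp: p_def dag_def ennreal_prod_eq_0_iff zero_less_iff_neq_zero)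
  ultimately show ?thesis by blast
qed

text \<open>If \<open>(u, v)\<close> is missing, \<open>separated_support\<close> mixes two patterns
  of the support: bit True, or bit False, on all of \<open>A\<close> and at \<open>u\<close>, and
  False elsewhere. The mixture has True at \<open>u\<close> and False at \<open>v\<close>; copying
  spreads False to \<open>t\<close>, against the rule that links \<open>u\<close> and
  \<open>t\<close>.\<close>

lemma joined_earlier:
  fixes X :: "'n \<Rightarrow> (nat \<Rightarrow> real) measure" and r :: "'n \<Rightarrow> nat"
  assumes dags: "dag N E" "dag N E'" and X: "\<And>s. state_space (X s)"
    and sub: "model N E X \<subseteq> model N E' X" and rev: "E\<inverse> \<subseteq> E'"
    and inj: "inj_on r N" and rank: "\<And>a b. (a, b) \<in> E' \<Longrightarrow> r a < r b"
    and s: "s \<in> N" and v: "v \<in> insert s (des E s)" and t: "t \<in> insert s (des E s)"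
    and u: "r u < r v" "r v \<le> r t" "(u, t) \<in> moral N E"
  shows "(u, v) \<in> E'"
proof (rule ccontr)
  assume nE: "(u, v) \<notin> E'"
  have fin: "finite N" and EN: "E \<subseteq> N \<times> N" and EN': "E' \<subseteq> N \<times> N" and acyc: "acyclic E"
    using dags by (auto simp: dag_def)
  have "E\<^sup>+ \<subseteq> N \<times> N"
    using EN by (rule trancl_subset_Sigma)
  then have S_N: "insert s (des E s) \<subseteq> N"
    using s by (auto simp: des_def)
  have desc: "r b < r a" if "(a, b) \<in> E" for a b
    using that rank rev by blast
  have desc_trancl: "r b < r a" if "(a, b) \<in> E\<^sup>+" for a b
    using that by induction (use desc in \<open>auto intro: less_trans\<close>)
  have uN: "u \<in> N"
    using u(3) EN by (auto simp: moral_def pa_def)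
  define A where "A = {a \<in> insert s (des E s). r v \<le> r a}"
  have AN: "A \<subseteq> N" and "v \<in> A" "t \<in> A"
    using S_N v t u(2) by (auto simp: A_def)
  have uA: "u \<notin> A"
    using u by (auto simp: A_def)
  have sA: "s \<in> A"
    using v desc_trancl by (force simp: A_def des_def)
  \<comment> \<open>The predecessor of \<open>a\<close> on a path from \<open>s\<close> has larger
    rank than \<open>a\<close>, so it stays in \<open>A\<close>.\<close>
  have "\<exists>b. b \<in> A \<and> (b, a) \<in> E" if "a \<in> A" "a \<noteq> s" for a
  proof -
    have "(s, a) \<in> E\<^sup>+" "r v \<le> r a"
      using that by (auto simp: A_def des_def)
    then obtain b where "(b, a) \<in> E" "b = s \<or> (s, b) \<in> E\<^sup>+"
      by (metis tranclE)
    then show ?thesis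
      using \<open>r v \<le> r a\<close> sA desc[of b a] by (intro exI[of _ b]) (auto simp: A_def des_def)
  qed
  then obtain par where par: "\<And>a. a \<in> A \<Longrightarrow> a \<noteq> s \<Longrightarrow> par a \<in> A \<and> (par a, a) \<in> E"
    by metis
  have "\<forall>a. \<exists>C :: bool \<Rightarrow> _. C True \<inter> C False = {} \<and>
    (\<forall>i. C i \<in> sets (X a) \<and> 0 < emeasure (X a) (C i) \<and> emeasure (X a) (C i) < \<infinity>)"
    using X state_space_split by blast
  then obtain C :: "'n \<Rightarrow> bool \<Rightarrow> (nat \<Rightarrow> real) set" where C_disj: "\<And>a. C a True \<inter> C a False = {}"
    and C: "\<And>a i. C a i \<in> sets (X a)" "\<And>a i. 0 < emeasure (X a) (C a i)"
      "\<And>a i. emeasure (X a) (C a i) < \<infinity>"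
    by metis
  have C_iff: "x \<in> C a True \<longleftrightarrow> i" if "x \<in> C a i" for x a i
    using that C_disj[of a] by (cases i) auto
  \<comment> \<open>\<^term>\<open>D a None\<close> leaves the bit of \<^term>\<open>a\<close> free, \<^term>\<open>D a (Some i)\<close> fixes it to \<^term>\<open>i\<close>.\<close>
  define D where "D = (\<lambda>a i. case i of None \<Rightarrow> C a True \<union> C a False | Some i \<Rightarrow> C a i)"
  have D: "D a i \<in> sets (X a) \<and> 0 < emeasure (X a) (D a i) \<and> emeasure (X a) (D a i) < \<infinity>" for a i
  proof (cases i)
    case None
    have "emeasure (X a) (C a True \<union> C a False) = emeasure (X a) (C a True) + emeasure (X a) (C a False)"
      using C C_disj by (intro plus_emeasure[symmetric]) auto
    then show ?thesis
      using C(1,2,3)[of a True] C(1,2,3)[of a False] None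
      by (simp add: D_def sets.Un add_pos_pos)
  qed (use C in \<open>auto simp: D_def\<close>)
  have bit_measurable: "(\<lambda>y. y b \<in> C b True) \<in> PiM (pa E a) X \<rightarrow>\<^sub>M count_space UNIV"
    if "b \<in> pa E a" for a b
    using that C(1)[of b True] by measurable
  have Some_measurable: "(\<lambda>y. Some (P y)) \<in> PiM (pa E a) X \<rightarrow>\<^sub>M count_space UNIV"
    if "P \<in> PiM (pa E a) X \<rightarrow>\<^sub>M count_space (UNIV :: bool set)" for P a
    using measurable_compose[OF that, of Some "count_space UNIV"] by simp
  \<comment> \<open>The part shared by both cases. \<open>h\<close> computes the bit of a node from
    its parents, \<open>None\<close> meaning a free bit; \<open>pos\<close> admits both constant
    patterns and \<open>zero\<close> excludes the mixed one.\<close>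
  have contra: False
    if h: "\<And>a. a \<in> N \<Longrightarrow> h a \<in> PiM (pa E a) X \<rightarrow>\<^sub>M count_space (UNIV :: bool option set)"
      and pos: "\<And>x \<beta> a. (\<And>b. x b \<in> C b True \<longleftrightarrow> \<beta> \<and> (b \<in> A \<or> b = u)) \<Longrightarrow>
        h a (restrict x (pa E a)) \<in> {None, Some (\<beta> \<and> (a \<in> A \<or> a = u))}"
      and copy: "\<And>a x. a \<in> A \<Longrightarrow> a \<noteq> s \<Longrightarrow> h a (restrict x (pa E a)) = Some (x (par a) \<in> C (par a) True)"
      and hs: "\<And>y. h s y = None"
      and zero: "\<And>x. x u \<in> C u True \<Longrightarrow> x t \<in> C t False \<Longrightarrow>
        (\<And>a. a \<in> N \<Longrightarrow> r a < r v \<Longrightarrow> a \<noteq> u \<Longrightarrow> x a \<in> C a False) \<Longrightarrow>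
        (\<forall>a\<in>N. x a \<in> D a (h a (restrict x (pa E a)))) \<Longrightarrow> False" for h
  proof -
    obtain p where p: "p \<in> borel_measurable (PiM N X)" "density (PiM N X) p \<in> model N E X"
      and p_iff: "\<And>x. p x > 0 \<longleftrightarrow> (\<forall>a\<in>N. x a \<in> D a (h a (restrict x (pa E a))))"
      using model_with_support[OF dags(1), of D X h] D h by blast
    \<comment> \<open>The boxes for True and False differ only on \<open>A\<close> and at
      \<open>u\<close>, hence only at \<open>u\<close> among the nodes ranked below
      \<open>v\<close>.\<close>
    define \<beta>C where "\<beta>C = (\<lambda>\<beta> a. C a (\<beta> \<and> (a \<in> A \<or> a = u)))"
    have p_pos: "p x > 0" if "x \<in> PiE N (\<beta>C \<beta>)" for x \<beta>
    proof -
      \<comment> \<open>\<^term>\<open>x\<close> is \<^term>\<open>undefined\<close> off \<^term>\<open>N\<close>, where \<open>pos\<close> expects bits as well.\<close>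
      have "\<exists>c. c \<in> \<beta>C \<beta> a" for a
        using C(2)[of a "\<beta> \<and> (a \<in> A \<or> a = u)"] unfolding \<beta>C_def
        by (metis emeasure_empty ex_in_conv less_irrefl)
      then obtain c where c: "\<And>a. c a \<in> \<beta>C \<beta> a" by metis
      define y where "y = (\<lambda>a. if a \<in> N then x a else c a)"
      have y: "y a \<in> C a (\<beta> \<and> (a \<in> A \<or> a = u))" for a
        using that c by (simp add: y_def \<beta>C_def PiE_iff)
      have "y a \<in> D a (h a (restrict y (pa E a)))" for a
        using y[of a] pos[of y \<beta> a, OF C_iff[OF y]]
        by (cases "\<beta> \<and> (a \<in> A \<or> a = u)") (auto simp: D_def)
      then have "\<forall>a\<in>N. y a \<in> D a (h a (restrict y (pa E a)))"
        by blast
      moreover have "restrict y (pa E a) = restrict x (pa E a)" for a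
        using EN by (auto simp: y_def pa_def restrict_def fun_eq_iff)
      ultimately show ?thesis
        by (simp add: p_iff y_def)
    qed
    have "product_sigma_finite X"
      using X state_space_sigma_finite by (simp add: product_sigma_finite_def)
    then have "\<exists>x\<in>space (PiM N X). (\<forall>a\<in>N. r a < r v \<longrightarrow> x a \<in> \<beta>C True a) \<and> x v \<in> \<beta>C False v \<and> p x > 0"
    proof (rule separated_support[where E = E' and u = u and S = "\<beta>C True" and T = "\<beta>C False"])
      show "density (PiM N X) p \<in> model N E' X"
        using p(2) sub by blast
      show "\<beta>C i a \<in> sets (X a) \<and> 0 < emeasure (X a) (\<beta>C i a)" for i a
        using C by (simp add: \<beta>C_def)
      \<comment> \<open>The same fact serves for \<open>S\<close> and for \<open>T\<close>.\<close>
      from this show "\<beta>C i a \<in> sets (X a) \<and> 0 < emeasure (X a) (\<beta>C i a)" for i a .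
      show "\<beta>C True a = \<beta>C False a" if "a \<in> N" "r a < r v" "a \<noteq> u" for a
        using that by (auto simp: \<beta>C_def A_def)
    qed (use fin EN' inj rank p(1) uN u(1) nE AN \<open>v \<in> A\<close> p_pos in \<open>auto\<close>)
    then obtain x where x: "\<And>a. a \<in> N \<Longrightarrow> r a < r v \<Longrightarrow> x a \<in> C a (a = u)"
        "x v \<in> C v False" "\<And>a. a \<in> N \<Longrightarrow> x a \<in> D a (h a (restrict x (pa E a)))"
      unfolding p_iff by (fastforce simp: \<beta>C_def A_def)
    define \<beta> where "\<beta> = (x s \<in> C s True)"
    \<comment> \<open>Induction along \<open>E\<close> carries the bit \<beta> of \<open>s\<close>
      through \<open>A\<close> via \<open>par\<close>; the cell of \<open>v\<close> then forces it
      to be False.\<close>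
    have "wf E"
      using fin EN acyc by (meson finite_SigmaI finite_acyclic_wf finite_subset)
    then have chain: "a \<in> A \<Longrightarrow> x a \<in> C a \<beta>" for a
    proof (induction a rule: wf_induct_rule)
      case (less a)
      show ?case
      proof (cases "a = s")
        case True
        then show ?thesis
          using x(3)[OF s] hs C_iff[of "x s" s False] by (auto simp: D_def \<beta>_def)
      next
        case False
        with less have "x (par a) \<in> C (par a) \<beta>"
          using par by blast
        then show ?thesis
          using x(3)[of a] copy[OF less.prems False, of x] less.prems AN C_iff by (auto simp: D_def)
      qed
    qed
    have "\<not> \<beta>"
      using chain[OF \<open>v \<in> A\<close>] x(2) C_disj[of v] by (cases \<beta>) auto
    show False
    proof (rule zero[of x])
      show "x u \<in> C u True"
        using x(1)[OF uN u(1)] by simp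
      show "x t \<in> C t False"
        using chain[OF \<open>t \<in> A\<close>] \<open>\<not> \<beta>\<close> by simp
    qed (use x in \<open>force+\<close>)
  qed
  have par_pa: "par a \<in> pa E a" if "a \<in> A" "a \<noteq> s" for a
    using par that by (simp add: pa_def)
  \<comment> \<open>Such an edge would give \<open>r t < r u\<close>. The moral edge therefore comes
    from an edge from \<open>t\<close> to \<open>u\<close> or from a common child.\<close>
  have "(u, t) \<notin> E"
    using desc u by fastforce
  with u(3) consider "(t, u) \<in> E" | c where "c \<in> N" "(t, c) \<in> E" "(u, c) \<in> E" "u \<noteq> t"
    by (auto simp: moral_def pa_def)
  then show False
  proof cases
    case 1
    \<comment> \<open>Here \<open>u\<close> copies the bit of \<open>t\<close>, so the two cannot
      differ.\<close>
    define h where "h = (\<lambda>a y. if a = s then None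
      else if a \<in> A then Some (y (par a) \<in> C (par a) True)
      else if a = u then Some (y t \<in> C t True)
      else Some False)"
    have tu: "t \<in> pa E u"
      using 1 by (simp add: pa_def)
    show False
    proof (rule contra[of h])
      show "h a \<in> PiM (pa E a) X \<rightarrow>\<^sub>M count_space UNIV" for a
        by (cases "a = s"; cases "a \<in> A"; cases "a = u")
          (simp_all add: h_def Some_measurable bit_measurable par_pa tu)
      show "h a (restrict x (pa E a)) \<in> {None, Some (\<beta> \<and> (a \<in> A \<or> a = u))}"
        if "\<And>b. x b \<in> C b True \<longleftrightarrow> \<beta> \<and> (b \<in> A \<or> b = u)" for x \<beta> a
        by (cases "a = s"; cases "a \<in> A"; cases "a = u")
          (use par[of a] in \<open>simp_all add: h_def that par_pa \<open>t \<in> A\<close> tu uA\<close>)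
      show False if "x u \<in> C u True" "x t \<in> C t False"
          "\<forall>a\<in>N. x a \<in> D a (h a (restrict x (pa E a)))" for x
        using bspec[OF that(3) uN] C_iff[OF that(2)] that(1) C_disj[of u] uA sA tu
        by (auto simp: h_def D_def split: if_splits)
    qed (use par_pa in \<open>auto simp: h_def\<close>)
  next
    case 2
    \<comment> \<open>In the constant patterns \<open>u\<close> and \<open>t\<close> both carry
      \<beta>, so their exclusive or is False. In the mixed one it is True, yet \<open>c\<close>,
      ranked below \<open>u\<close>, must show False.\<close>
    define h where "h = (\<lambda>a y. if a = s then None
      else if a \<in> A then Some (y (par a) \<in> C (par a) True)
      else if a = u then None
      else if a = c then Some ((y u \<in> C u True) \<noteq> (y t \<in> C t True))
      else Some False)"
    have tc: "t \<in> pa E c" "u \<in> pa E c"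
      using 2 by (simp_all add: pa_def)
    have rc: "r c < r u"
      using 2 desc by blast
    then have cA: "c \<notin> A" "c \<noteq> u"
      using u by (auto simp: A_def)
    show False
    proof (rule contra[of h])
      have "(\<lambda>y. (y u \<in> C u True) \<noteq> (y t \<in> C t True)) \<in> PiM (pa E c) X \<rightarrow>\<^sub>M count_space UNIV"
        using bit_measurable[OF tc(1)] bit_measurable[OF tc(2)] by measurable
      then show "h a \<in> PiM (pa E a) X \<rightarrow>\<^sub>M count_space UNIV" for a
        by (cases "a = s"; cases "a \<in> A"; cases "a = u"; cases "a = c")
          (simp_all add: h_def Some_measurable bit_measurable par_pa)
      show "h a (restrict x (pa E a)) \<in> {None, Some (\<beta> \<and> (a \<in> A \<or> a = u))}"
        if "\<And>b. x b \<in> C b True \<longleftrightarrow> \<beta> \<and> (b \<in> A \<or> b = u)" for x \<beta> a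
        by (cases "a = s"; cases "a \<in> A"; cases "a = u"; cases "a = c")
          (use par[of a] in \<open>simp_all add: h_def that par_pa \<open>t \<in> A\<close> tc uA cA\<close>)
      show False if "x u \<in> C u True" "x t \<in> C t False"
          "\<And>a. a \<in> N \<Longrightarrow> r a < r v \<Longrightarrow> a \<noteq> u \<Longrightarrow> x a \<in> C a False"
          "\<forall>a\<in>N. x a \<in> D a (h a (restrict x (pa E a)))" for x
        using bspec[OF that(4) 2(1)] that(3)[OF 2(1)] C_iff[OF that(2)] that(1) rc u(1)
          C_disj[of c] uA sA tc cA
        by (auto simp: h_def D_def split: if_splits)
    qed (use par_pa uA in \<open>auto simp: h_def\<close>)
  qed
qed

section \<open>Construction of the perfect subgraphs\<close>

theorem theorem3:
  fixes N :: "'n set" and E E' :: "('n \<times> 'n) set"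
    and X :: "'n \<Rightarrow> (nat \<Rightarrow> real) measure"
  assumes "dag N E" and "dag N E'"
    and "\<forall>s\<in>N. state_space (X s)"
    and "model N E X \<subseteq> model N E' X"
    and "E\<inverse> \<subseteq> E'"
  shows "moral N E \<subseteq> undir E' \<and>
    (\<forall>s\<in>N. \<exists>VH EH.
        VH \<subseteq> insert s (des E s) \<and> EH \<subseteq> induced E' (insert s (des E s)) \<and>
        EH \<subseteq> VH \<times> VH \<and> perfect VH EH \<and>
        insert s (des E s) \<subseteq> VH \<and>
        induced (moral N E) (insert s (des E s)) \<subseteq> undir EH)"
proof -
  have fin: "finite N" and EN: "E \<subseteq> N \<times> N" and EN': "E' \<subseteq> N \<times> N"
    and acyc: "acyclic E" "acyclic E'"
    using assms(1,2) by (auto simp: dag_def)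
  have moral_N: "moral N E \<subseteq> N \<times> N" and moral_sym: "\<And>a b. (a, b) \<in> moral N E \<Longrightarrow> (b, a) \<in> moral N E"
    using EN by (auto simp: moral_def pa_def)
  have moral_irrefl: "(a, a) \<notin> moral N E" for a
    using acyc(1) by (auto simp: moral_def acyclic_def)
  have "finite E'"
    using fin EN' finite_subset by blast
  then obtain r :: "'n \<Rightarrow> nat" where inj: "inj_on r N" and "\<forall>a\<in>N. \<forall>b\<in>N. (a, b) \<in> E' \<longrightarrow> r a < r b"
    using topological_rank[OF fin _ acyc(2)] by blast
  then have rank: "\<And>a b. (a, b) \<in> E' \<Longrightarrow> r a < r b"
    using EN' by blast
  \<comment> \<open>Product measures need \<open>\<sigma>\<close>-finite factors at all indices, including those off \<^term>\<open>N\<close>.\<close>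
  define Y where "Y = (\<lambda>s. if s \<in> N then X s else PiM {..<1::nat} (\<lambda>_. lborel))"
  have Y: "state_space (Y s)" for s
    using assms(3) by (auto simp: Y_def state_space_def)
  have "model N E Y \<subseteq> model N E' Y"
    using assms(4) model_cong[OF EN, of X Y] model_cong[OF EN', of X Y] by (simp add: Y_def)
  then have key: "(u, v) \<in> E'" if "s \<in> N" "v \<in> insert s (des E s)" "t \<in> insert s (des E s)"
    "r u < r v" "r v \<le> r t" "(u, t) \<in> moral N E" for s t u v
    by (rule joined_earlier[OF assms(1,2) Y _ assms(5) inj rank that])
  have "moral N E \<subseteq> undir E'"
  proof clarify
    fix a b assume ab: "(a, b) \<in> moral N E"
    then have "a \<in> N" "b \<in> N" "a \<noteq> b"
      using moral_N moral_irrefl by auto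
    then consider "r a < r b" | "r b < r a"
      using inj by (metis inj_on_def linorder_neqE_nat)
    \<comment> \<open>The endpoint of larger rank serves as \<open>s\<close>, \<open>v\<close> and
      \<open>t\<close> at once.\<close>
    then show "(a, b) \<in> undir E'"
      using key[of b b b a] key[of a a a b] ab moral_sym[OF ab] \<open>a \<in> N\<close> \<open>b \<in> N\<close>
      by cases (auto simp: undir_def)
  qed
  moreover have "\<exists>VH EH.
        VH \<subseteq> insert s (des E s) \<and> EH \<subseteq> induced E' (insert s (des E s)) \<and>
        EH \<subseteq> VH \<times> VH \<and> perfect VH EH \<and>
        insert s (des E s) \<subseteq> VH \<and>
        induced (moral N E) (insert s (des E s)) \<subseteq> undir EH" if s: "s \<in> N" for s
  proof -
    define S where "S = insert s (des E s)"
    have "E\<^sup>+ \<subseteq> N \<times> N"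
      using EN by (rule trancl_subset_Sigma)
    then have SN: "S \<subseteq> N"
      using s by (auto simp: S_def des_def)
    define EH where "EH = {(u, v). u \<in> S \<and> v \<in> S \<and> r u < r v \<and> (\<exists>t\<in>S. r v \<le> r t \<and> (u, t) \<in> moral N E)}"
    have "EH \<subseteq> induced E' S"
      using key[OF s] by (auto simp: EH_def induced_def S_def)
    moreover have "perfect S EH"
      unfolding perfect_def complete_def
    proof (intro ballI impI)
      fix v a b assume *: "v \<in> S" "a \<in> pa EH v" "b \<in> pa EH v" "a \<noteq> b"
      \<comment> \<open>The witness \<open>t\<close> of the edge from \<open>a\<close> to
        \<open>v\<close> also serves the edge from \<open>a\<close> to \<open>b\<close>, since
        \<open>r b < r v\<close> and \<open>r v \<le> r t\<close>.\<close>
      have edge: "(a, b) \<in> EH" if "a \<in> pa EH v" "b \<in> pa EH v" "r a < r b" for a b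
        using that by (simp add: EH_def pa_def) (meson less_imp_le less_le_trans)
      have "a \<in> N" "b \<in> N"
        using * SN by (auto simp: EH_def pa_def)
      then have "r a < r b \<or> r b < r a"
        using inj *(4) by (metis inj_on_def linorder_neqE_nat)
      then show "joined EH a b"
        using edge * by (auto simp: joined_def)
    qed
    moreover have "induced (moral N E) S \<subseteq> undir EH"
    proof clarify
      fix a b assume "(a, b) \<in> induced (moral N E) S"
      then have ab: "(a, b) \<in> moral N E" "a \<in> S" "b \<in> S"
        by (auto simp: induced_def)
      then have "r a < r b \<or> r b < r a"
        using inj SN moral_irrefl by (metis inj_on_def linorder_neqE_nat subsetD)
      \<comment> \<open>The endpoint of larger rank is its own witness \<open>t\<close>.\<close>
      then show "(a, b) \<in> undir EH"
        using ab moral_sym[OF ab(1)] by (auto simp: undir_def EH_def)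
    qed
    moreover have "EH \<subseteq> S \<times> S"
      by (auto simp: EH_def)
    ultimately show ?thesis
      unfolding S_def[symmetric] by blast
  qed
  ultimately show ?thesis by blast
qed

end
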